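(* Let $N\ge 1$ be an integer, $a>0$, $0<\alpha<1$, $\lambda\in\mathbb{C}\setminus\{0\}$ with $\lambda_1=\Re\lambda$, $\lambda_2=\Im\lambda$, let $\gamma>0$, and let $p$ satisfy $$1+\gamma<p<1+\frac{\gamma}{\alpha}.$$ Let $f\in L^1(\mathbb{R}^N,\mathbb{C})$, $f_1=\Re f$, $f_2=\Im f$, $r_\alpha=\cos(\pi\alpha/2)$, $s_\alpha=\sin(\pi\alpha/2)$, and suppose that $$\lambda_1\int_{\mathbb{R}^N}\bigl(r_\alpha f_1(x)-s_\alpha f_2(x)\bigr)\,dx>0\quad\text{or}\quad \lambda_2\int_{\mathbb{R}^N}\bigl(s_\alpha f_1(x)+r_\alpha f_2(x)\bigr)\,dx>0.$$ Then the initial value problem $$i^\alpha \mathcal{D}_{a|t}^\alpha u+\Delta u=\lambda\left(\ln\frac{t}{a}\right)^\gamma|u|^p,\quad t>a,\ x\in\mathbb{R}^N,\qquad u(a,x)=f(x),\quad x\in\mathbb{R}^N,$$ admits no global weak solution.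
   Context: Here $u=u(t,x)$ is complex-valued, $i^\alpha=e^{i\alpha\pi/2}$, $\Delta$ is the Laplacian in $x$, and $\mathcal{D}_{a|t}^\alpha$ is the left/forward Hadamard-Caputo fractional derivative of order $\alpha\in(0,1)$ in $t$, $(\mathcal{D}_{a|t}^\alpha u)(t,x)=\frac{1}{\Gamma(1-\alpha)}\int_a^t\left(\ln\frac{t}{s}\right)^{-\alpha}\frac{\partial u}{\partial s}(s,x)\,ds$. Write $u_1=\Re u$, $u_2=\Im u$. For $T>a$ let $Q_T=[a,T]\times\mathbb{R}^N$ and let $\Phi_T$ be the set of real-valued functions $\varphi\in C^{1,2}_{t,x}(Q_T,\mathbb{R})$ (once continuously differentiable in $t$, twice in $x$) with $\mathrm{supp}_x\,\varphi\subset\subset\mathbb{R}^N$ (compact support in $x$). For $\sigma>0$, the right-sided Hadamard fractional integral in $t$ is $(J_{T|t}^\sigma v)(t,x)=\frac{1}{\Gamma(\sigma)}\int_t^T\left(\ln\frac{s}{t}\right)^{\sigma-1}v(s,x)\frac{1}{s}\,ds$. The notation $J_{T|t}^{1-\alpha}\,t\varphi$ means $J_{T|t}^{1-\alpha}$ applied to the function $(t,x)\mapsto t\varphi(t,x)$, i.e. $(J_{T|t}^{1-\alpha}\,t\varphi)(t,x)=\frac{1}{\Gamma(1-\alpha)}\int_t^T\left(\ln\frac{s}{t}\right)^{-\alpha}\varphi(s,x)\,ds$. Definition. $u$ is a global weak solution of the problem if: (i) $u\in L^1_{loc}([a,\infty)\times\mathbb{R}^N,\mathbb{C})$ and $\left(\ln\frac{t}{a}\right)^\gamma|u|^p\in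 L^1_{loc}([a,\infty)\times\mathbb{R}^N,\mathbb{R})$; (ii) for all $T>a$ and all $\varphi\in\Phi_T$, $$\lambda_1\int_{Q_T}\left(\ln\frac{t}{a}\right)^\gamma|u|^p\varphi\,dx\,dt+\int_{\mathbb{R}^N}(r_\alpha f_1(x)-s_\alpha f_2(x))(J_{T|t}^{1-\alpha}\,t\varphi)(a,x)\,dx=\int_{Q_T}u_1\Delta\varphi\,dx\,dt-\int_{Q_T}(r_\alpha u_1-s_\alpha u_2)\frac{\partial (J_{T|t}^{1-\alpha}\,t\varphi)}{\partial t}\,dx\,dt$$ and $$\lambda_2\int_{Q_T}\left(\ln\frac{t}{a}\right)^\gamma|u|^p\varphi\,dx\,dt+\int_{\mathbb{R}^N}(s_\alpha f_1(x)+r_\alpha f_2(x))(J_{T|t}^{1-\alpha}\,t\varphi)(a,x)\,dx=\int_{Q_T}u_2\Delta\varphi\,dx\,dt-\int_{Q_T}(s_\alpha u_1+r_\alpha u_2)\frac{\partial (J_{T|t}^{1-\alpha}\,t\varphi)}{\partial t}\,dx\,dt.$$ *)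

theory Defs
  imports "HOL-Analysis.Analysis"
begin

definition Q :: "real \<Rightarrow> real \<Rightarrow> (real \<times> (real^'n)) set" where
  "Q a T = {a..T} \<times> UNIV"

definition L1_loc :: "'a::euclidean_space set \<Rightarrow> ('a \<Rightarrow> 'b::euclidean_space) \<Rightarrow> bool" where
  "L1_loc S g \<longleftrightarrow> (\<forall>K. compact K \<and> K \<subseteq> S \<longrightarrow> g absolutely_integrable_on K)"

definition pdiffable :: "'n \<Rightarrow> (real^'n \<Rightarrow> real) \<Rightarrow> real^'n \<Rightarrow> bool" where
  "pdiffable i g x \<longleftrightarrow> (\<lambda>h. g (x + h *\<^sub>R axis i 1)) differentiable (at 0)"

definition pderivative :: "'n \<Rightarrow> (real^'n \<Rightarrow> real) \<Rightarrow> real^'n \<Rightarrow> real" where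
  "pderivative i g x = vector_derivative (\<lambda>h. g (x + h *\<^sub>R axis i 1)) (at 0)"

definition laplacian :: "(real^'n \<Rightarrow> real) \<Rightarrow> real^'n \<Rightarrow> real" where
  "laplacian g x = (\<Sum>i\<in>UNIV. pderivative i (pderivative i g) x)"

text \<open>The time derivative is one-sided at the two endpoints, so that only the values of
  \<open>\<phi>\<close> on \<open>Q a T\<close> matter.  Continuity is joint in \<open>(t, x)\<close>.\<close>

definition C12 :: "real \<Rightarrow> real \<Rightarrow> (real \<Rightarrow> real^'n \<Rightarrow> real) \<Rightarrow> bool" where
  "C12 a T \<phi> \<longleftrightarrow>
     continuous_on (Q a T) (\<lambda>(t, x). \<phi> t x) \<and>
     (\<forall>t\<in>{a..T}. \<forall>x. (\<lambda>s. \<phi> s x) differentiable (at t within {a..T})) \<and>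
     continuous_on (Q a T) (\<lambda>(t, x). vector_derivative (\<lambda>s. \<phi> s x) (at t within {a..T})) \<and>
     (\<forall>i. (\<forall>t\<in>{a..T}. \<forall>x. pdiffable i (\<phi> t) x) \<and>
          continuous_on (Q a T) (\<lambda>(t, x). pderivative i (\<phi> t) x)) \<and>
     (\<forall>i j. (\<forall>t\<in>{a..T}. \<forall>x. pdiffable j (pderivative i (\<phi> t)) x) \<and>
          continuous_on (Q a T) (\<lambda>(t, x). pderivative j (pderivative i (\<phi> t)) x))"

definition test_functions :: "real \<Rightarrow> real \<Rightarrow> (real \<Rightarrow> real^'n \<Rightarrow> real) set" where
  "test_functions a T =
     {\<phi>. C12 a T \<phi> \<and> compact (closure {x. \<exists>t\<in>{a..T}. \<phi> t x \<noteq> 0})}"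

definition hadamard_J ::
  "real \<Rightarrow> real \<Rightarrow> (real \<Rightarrow> real^'n \<Rightarrow> real) \<Rightarrow> real \<Rightarrow> real^'n \<Rightarrow> real" where
  "hadamard_J \<sigma> T v t x =
     1 / Gamma \<sigma> * (LINT s:{t..T}|lebesgue. ln (s / t) powr (\<sigma> - 1) * v s x * (1 / s))"

definition J_test ::
  "real \<Rightarrow> real \<Rightarrow> (real \<Rightarrow> real^'n \<Rightarrow> real) \<Rightarrow> real \<Rightarrow> real^'n \<Rightarrow> real" where
  "J_test \<alpha> T \<phi> = hadamard_J (1 - \<alpha>) T (\<lambda>s x. s * \<phi> s x)"

definition dt_J_test ::
  "real \<Rightarrow> real \<Rightarrow> real \<Rightarrow> (real \<Rightarrow> real^'n \<Rightarrow> real) \<Rightarrow> real \<Rightarrow> real^'n \<Rightarrow> real" where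
  "dt_J_test \<alpha> a T \<phi> t x = vector_derivative (\<lambda>s. J_test \<alpha> T \<phi> s x) (at t within {a..T})"

text \<open>Weak solutions of
  \<open>i\<^sup>\<alpha> D\<^sup>\<alpha> u + \<Delta> u = \<lambda> (ln (t/a))\<^sup>\<gamma> |u|\<^sup>p\<close>, \<open>u(a, \<cdot>) = f\<close>, where \<open>D\<^sup>\<alpha>\<close> is the
  forward Hadamard-Caputo derivative in \<open>t\<close> based at \<open>a\<close>.

  Test functions need not vanish at \<open>t = T\<close>, so \<open>dt_J_test \<alpha> a T \<phi>\<close> may be singular there
  and its product with \<open>u\<close> need not be integrable.  No integrability clause is
  imposed in that case; the integral then has the value \<open>0\<close>.  Imposing one would only
  shrink the class of solutions.\<close>

definition global_weak_solution ::
  "real \<Rightarrow> real \<Rightarrow> complex \<Rightarrow> real \<Rightarrow> real \<Rightarrow> (real^'n \<Rightarrow> complex)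
     \<Rightarrow> (real \<Rightarrow> real^'n \<Rightarrow> complex) \<Rightarrow> bool" where
  "global_weak_solution a \<alpha> lam \<gamma> p f u \<longleftrightarrow>
     (let r = cos (pi * \<alpha> / 2); s = sin (pi * \<alpha> / 2) in
      L1_loc ({a..} \<times> UNIV) (\<lambda>(t, x). u t x) \<and>
      L1_loc ({a..} \<times> UNIV) (\<lambda>(t, x). ln (t / a) powr \<gamma> * norm (u t x) powr p) \<and>
      (\<forall>T>a. \<forall>\<phi>\<in>test_functions a T.
         Re lam * (LINT (t, x):Q a T|lebesgue. ln (t / a) powr \<gamma> * norm (u t x) powr p * \<phi> t x)
           + (LINT x|lebesgue. (r * Re (f x) - s * Im (f x)) * J_test \<alpha> T \<phi> a x)
         = (LINT (t, x):Q a T|lebesgue. Re (u t x) * laplacian (\<phi> t) x)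
           - (LINT (t, x):Q a T|lebesgue.
                (r * Re (u t x) - s * Im (u t x)) * dt_J_test \<alpha> a T \<phi> t x) \<and>
         Im lam * (LINT (t, x):Q a T|lebesgue. ln (t / a) powr \<gamma> * norm (u t x) powr p * \<phi> t x)
           + (LINT x|lebesgue. (s * Re (f x) + r * Im (f x)) * J_test \<alpha> T \<phi> a x)
         = (LINT (t, x):Q a T|lebesgue. Im (u t x) * laplacian (\<phi> t) x)
           - (LINT (t, x):Q a T|lebesgue.
                (s * Re (u t x) + r * Im (u t x)) * dt_J_test \<alpha> a T \<phi> t x)))"

end

theory Submission
  imports Defs
begin

text \<open>
  Test the weak formulation with \<open>\<phi>(t, x) = \<theta>(t) \<psi>(x)\<close>, where
  \<open>\<theta>(t) = (ln (T/t) / S)\<^sup>n / t\<close> with \<open>S = ln (T/a)\<close>, and \<open>\<psi>\<close> is a \<open>C\<^sup>2\<close> bump with compact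
  support. The factor \<open>1/t\<close> makes \<open>J (t \<phi>)\<close> an explicit Beta integral, equal to
  \<open>c \<psi> S^(-n) (ln (T/t))^(n + 1 - \<alpha>)\<close>. For large exponents, both \<open>\<Delta>\<phi>\<close> and the time derivative of
  \<open>J (t \<phi>)\<close> are bounded by \<open>K \<phi>^(1/p) (1/t)^(1 - 1/p)\<close> with \<open>K\<close> independent of \<open>T\<close>, so Young's inequality
  absorbs \<open>|u|\<close> into the nonlinear term and leaves
  \<open>c |\<integral> F \<psi>| S^(1 - \<alpha>) \<le> M S^(1 - \<delta>)\<close> with \<open>\<delta> = \<gamma> / (p - 1)\<close>, where \<open>F\<close> is the combination of
  \<open>f\<^sub>1, f\<^sub>2\<close> in the hypothesis. The condition \<open>1 + \<gamma> < p\<close> gives \<open>\<delta> < 1\<close>, which makes the weight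
  integrable at \<open>t = a\<close>, and \<open>p < 1 + \<gamma>/\<alpha>\<close> gives \<open>\<delta> > \<alpha>\<close>, so for a fixed bump with
  \<open>\<integral> F \<psi>\<close> close to \<open>\<integral> F\<close> the inequality fails as \<open>T \<longrightarrow> \<infinity>\<close>.
\<close>

section \<open>A compactly supported spatial bump and its derivatives\<close>

text \<open>Only \<open>y = 0\<close> is delicate: there the difference quotient is
  \<open>max 0 h ^ (k + 1)\<close>, which tends to 0. The exponent is written \<open>k + 2\<close>
  to avoid subtraction of natural numbers in the derivative.\<close>

lemma DERIV_max_0_power:
  fixes y :: real
  shows "((\<lambda>y. max 0 y ^ (k + 2)) has_real_derivative real (k + 2) * max 0 y ^ (k + 1)) (at y)"
proof -
  consider "y > 0" | "y < 0" | "y = 0" by linarith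
  then show ?thesis
  proof cases
    case 1
    have "((\<lambda>y. y ^ (k + 2)) has_real_derivative real (k + 2) * max 0 y ^ (k + 1)) (at y)"
      using DERIV_pow[of "k + 2" y] 1 by simp
    then show ?thesis
      by (rule has_field_derivative_transform_within_open[where S="{0<..}"]) (use 1 in auto)
  next
    case 2
    have "((\<lambda>y. 0) has_real_derivative real (k + 2) * max 0 y ^ (k + 1)) (at y)"
      using 2 by (auto intro!: derivative_eq_intros)
    then show ?thesis
      by (rule has_field_derivative_transform_within_open[where S="{..<0}"]) (use 2 in auto)
  next
    case 3
    have *: "((\<lambda>h::real. max 0 h ^ (k + 1)) \<longlongrightarrow> max 0 0 ^ (k + 1)) (at 0)"
      by (intro tendsto_intros)
    have "((\<lambda>h::real. max 0 h ^ (k + 2) / h) \<longlongrightarrow> 0) (at 0)"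
    proof (rule Lim_transform_eventually)
      show "((\<lambda>h::real. max 0 h ^ (k + 1)) \<longlongrightarrow> 0) (at 0)" using * by simp
      show "\<forall>\<^sub>F h::real in at 0. max 0 h ^ (k + 1) = max 0 h ^ (k + 2) / h"
        by (auto simp: eventually_at_filter max_def)
    qed
    then show ?thesis using 3 by (simp add: DERIV_def)
  qed
qed

text \<open>A power of one truncated quadratic takes the place of a smooth cut-off: differentiation
  merely lowers the exponent, so derivatives can be compared with roots of the bump itself.\<close>

definition bump :: "real \<Rightarrow> nat \<Rightarrow> real^'n \<Rightarrow> real" where
  "bump R k x = max 0 (1 - (x \<bullet> x) / R\<^sup>2) ^ k"

lemma bump_nonneg: "0 \<le> bump R k x" and bump_le_1: "bump R k x \<le> 1"
  by (auto simp: bump_def intro!: power_le_one)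

lemma bump_antimono: "j \<le> k \<Longrightarrow> bump R k x \<le> bump R j x"
  unfolding bump_def by (rule power_decreasing) auto

lemma bump_eq_0:
  assumes "R > 0" "R < norm x" "0 < k"
  shows "bump R k x = 0"
proof -
  have "R\<^sup>2 < x \<bullet> x"
    using power_strict_mono[OF assms(2), of 2] assms(1) by (simp add: power2_norm_eq_inner)
  then show ?thesis using assms by (simp add: bump_def max_def field_simps)
qed

lemma continuous_bump [continuous_intros]:
  "continuous_on A g \<Longrightarrow> continuous_on A (\<lambda>z. bump R k (g z))"
  unfolding bump_def divide_inverse by (intro continuous_intros)

lemma pderivative_eqI:
  assumes "((\<lambda>h. g (x + h *\<^sub>R axis i 1)) has_real_derivative D) (at 0)"
  shows "pdiffable i g x" "pderivative i g x = D"
  using assms unfolding pdiffable_def pderivative_def has_real_derivative_iff_has_vector_derivative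
  by (auto simp: vector_derivative_at differentiableI_vector)

lemma DERIV_bump_axis:
  assumes "R > 0"
  shows "((\<lambda>h. bump R (k + 2) (x + h *\<^sub>R axis i 1)) has_real_derivative
    - (2 * real (k + 2) / R\<^sup>2) * (x $ i * bump R (k + 1) x)) (at 0)"
proof -
  have q: "((\<lambda>h. 1 - ((x + h *\<^sub>R axis i 1) \<bullet> (x + h *\<^sub>R axis i 1)) / R\<^sup>2) has_real_derivative
     - (2 * x $ i / R\<^sup>2)) (at 0)"
  proof -
    have "(x + h *\<^sub>R axis i 1) \<bullet> (x + h *\<^sub>R axis i 1) = x \<bullet> x + 2 * h * x $ i + h\<^sup>2" for h
      by (simp add: inner_left_distrib inner_right_distrib inner_axis inner_axis' power2_eq_square
        algebra_simps)
    then show ?thesis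
      using assms by (auto intro!: derivative_eq_intros simp: power2_eq_square)
  qed
  show ?thesis unfolding bump_def
    by (rule DERIV_cong[OF DERIV_chain2[OF DERIV_max_0_power q]]) (simp add: bump_def)
qed

lemma pderivative_bump:
  assumes "R > 0"
  shows "pdiffable i (\<lambda>x. c * bump R (k + 2) x) x"
    and "pderivative i (\<lambda>x. c * bump R (k + 2) x)
      = (\<lambda>x. c * (- (2 * real (k + 2) / R\<^sup>2) * (x $ i * bump R (k + 1) x)))"
  using pderivative_eqI[OF DERIV_cmult[OF DERIV_bump_axis[OF assms]]] by blast+

text \<open>The scalar \<open>c\<close> will be the time factor, which is constant in
  \<open>x\<close>. Starting from \<open>k + 3\<close> leaves the positive exponent
  \<open>k + 1\<close> after two derivatives, so these are continuous and vanish outside the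
  ball.\<close>

lemma pderivative_pderivative_bump:
  fixes x :: "real^'n"
  assumes "R > 0"
  shows "pdiffable j (pderivative i (\<lambda>x. c * bump R (k + 3) x)) x"
    and "pderivative j (pderivative i (\<lambda>x. c * bump R (k + 3) x))
      = (\<lambda>x. c * (- (2 * real (k + 3) / R\<^sup>2) *
           ((if i = j then bump R (k + 2) x else 0)
            - 2 * real (k + 2) / R\<^sup>2 * (x $ i * x $ j) * bump R (k + 1) x)))"
proof -
  have eq: "pderivative i (\<lambda>x. c * bump R (k + 3) x)
      = (\<lambda>x. c * (- (2 * real (k + 3) / R\<^sup>2) * (x $ i * bump R (k + 2) x)))"
    using pderivative_bump(2)[OF assms, of i c "k + 1"] by (simp add: algebra_simps numeral_3_eq_3)
  have D: "((\<lambda>h. c * (- (2 * real (k + 3) / R\<^sup>2) * ((x + h *\<^sub>R axis j 1) $ i * bump R (k + 2) (x + h *\<^sub>R axis j 1))))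
     has_real_derivative c * (- (2 * real (k + 3) / R\<^sup>2) *
           ((if i = j then bump R (k + 2) x else 0)
            - 2 * real (k + 2) / R\<^sup>2 * (x $ i * x $ j) * bump R (k + 1) x))) (at 0)" for x :: "real^'n"
  proof (intro DERIV_cmult)
    have "((\<lambda>h. (x + h *\<^sub>R axis j 1) $ i) has_real_derivative (if i = j then 1 else 0)) (at 0)"
      by (auto simp: axis_def intro!: derivative_eq_intros)
    from DERIV_mult[OF this DERIV_bump_axis[OF assms]]
    show "((\<lambda>h. (x + h *\<^sub>R axis j 1) $ i * bump R (k + 2) (x + h *\<^sub>R axis j 1)) has_real_derivative
       (if i = j then bump R (k + 2) x else 0)
            - 2 * real (k + 2) / R\<^sup>2 * (x $ i * x $ j) * bump R (k + 1) x) (at 0)"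
      by (rule DERIV_cong) (simp add: algebra_simps)
  qed
  show "pdiffable j (pderivative i (\<lambda>x. c * bump R (k + 3) x)) x"
    unfolding eq by (rule pderivative_eqI(1)[OF D])
  show "pderivative j (pderivative i (\<lambda>x. c * bump R (k + 3) x))
      = (\<lambda>x. c * (- (2 * real (k + 3) / R\<^sup>2) *
           ((if i = j then bump R (k + 2) x else 0)
            - 2 * real (k + 2) / R\<^sup>2 * (x $ i * x $ j) * bump R (k + 1) x)))"
    unfolding eq using pderivative_eqI(2)[OF D] by blast
qed

text \<open>Every term of a second derivative keeps at least the power \<open>k + 1\<close> of the
  base, and the coordinates \<open>x $ i\<close> are at most \<open>R\<close> in modulus wherever
  the bump is nonzero.\<close>

lemma abs_laplacian_bump_le:
  fixes x :: "real^'n"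
  assumes "R > 0"
  shows "\<bar>laplacian (\<lambda>x. c * bump R (k + 3) x) x\<bar>
    \<le> real CARD('n) * (2 * real (k + 3) / R\<^sup>2 * (1 + 2 * real (k + 2))) * (\<bar>c\<bar> * bump R (k + 1) x)"
proof -
  have *: "\<bar>pderivative i (pderivative i (\<lambda>x. c * bump R (k + 3) x)) x\<bar>
     \<le> (2 * real (k + 3) / R\<^sup>2 * (1 + 2 * real (k + 2))) * (\<bar>c\<bar> * bump R (k + 1) x)" for i
  proof -
    have 1: "(x $ i * x $ i) * bump R (k + 1) x \<le> R\<^sup>2 * bump R (k + 1) x"
    proof (cases "norm x \<le> R")
      case True
      then have "\<bar>x $ i\<bar> \<le> R" using component_le_norm_cart[of x i] by linarith
      then have "x $ i * x $ i \<le> R\<^sup>2" using power_mono[of "\<bar>x $ i\<bar>" R 2] by (simp add: power2_eq_square)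
      then show ?thesis by (intro mult_right_mono bump_nonneg)
    next
      case False
      then show ?thesis using bump_eq_0[OF assms, of x "k+1"] by simp
    qed
    have "\<bar>bump R (k + 2) x - 2 * real (k + 2) / R\<^sup>2 * (x $ i * x $ i) * bump R (k + 1) x\<bar>
      \<le> \<bar>bump R (k + 2) x\<bar> + \<bar>2 * real (k + 2) / R\<^sup>2 * (x $ i * x $ i) * bump R (k + 1) x\<bar>"
      by (rule abs_triangle_ineq4)
    also have "\<dots> = bump R (k + 2) x + 2 * real (k + 2) / R\<^sup>2 * ((x $ i * x $ i) * bump R (k + 1) x)"
      by (simp add: abs_mult bump_nonneg)
    also have "\<dots> \<le> bump R (k + 1) x + 2 * real (k + 2) / R\<^sup>2 * (R\<^sup>2 * bump R (k + 1) x)"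
      by (intro add_mono bump_antimono mult_left_mono 1) auto
    also have "\<dots> = (1 + 2 * real (k + 2)) * bump R (k + 1) x"
      using assms by (simp add: field_simps)
    finally have "\<bar>c\<bar> * (2 * real (k + 3) / R\<^sup>2) * \<bar>bump R (k + 2) x - 2 * real (k + 2) / R\<^sup>2 * (x $ i * x $ i) * bump R (k + 1) x\<bar>
       \<le> \<bar>c\<bar> * (2 * real (k + 3) / R\<^sup>2) * ((1 + 2 * real (k + 2)) * bump R (k + 1) x)"
      by (intro mult_left_mono) auto
    then show ?thesis
      unfolding pderivative_pderivative_bump(2)[OF assms] by (simp add: abs_mult mult_ac)
  qed
  have "\<bar>laplacian (\<lambda>x. c * bump R (k + 3) x) x\<bar> 
     \<le> (\<Sum>i\<in>(UNIV::'n set). \<bar>pderivative i (pderivative i (\<lambda>x. c * bump R (k + 3) x)) x\<bar>)"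
    unfolding laplacian_def by (rule sum_abs)
  also have "\<dots> \<le> (\<Sum>i\<in>(UNIV::'n set). (2 * real (k + 3) / R\<^sup>2 * (1 + 2 * real (k + 2))) * (\<bar>c\<bar> * bump R (k + 1) x))"
    by (intro sum_mono *)
  finally show ?thesis by (simp add: mult.assoc)
qed

lemma product_bump_in_test_functions:
  fixes \<theta> \<theta>' :: "real \<Rightarrow> real"
  assumes "R > 0" "a < T"
    and \<theta>': "\<And>t. t \<in> {a..T} \<Longrightarrow> (\<theta> has_real_derivative \<theta>' t) (at t within {a..T})"
    and "continuous_on {a..T} \<theta>'"
  shows "(\<lambda>t x. \<theta> t * bump R (k + 3) x) \<in> test_functions a T"
proof -
  have \<theta>: "continuous_on {a..T} \<theta>" using \<theta>' by (rule DERIV_continuous_on)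
  have fst: "continuous_on (Q a T) (\<lambda>z. h (fst z))" if "continuous_on {a..T} h" for h :: "real \<Rightarrow> real"
    by (rule continuous_on_compose2[OF that continuous_on_fst[OF continuous_on_id]]) (auto simp: Q_def)
  have D: "((\<lambda>s. \<theta> s * bump R (k + 3) x) has_vector_derivative \<theta>' t * bump R (k + 3) x) (at t within {a..T})"
    if "t \<in> {a..T}" for t x
    using DERIV_cmult_right[OF \<theta>'[OF that]] by (simp add: has_real_derivative_iff_has_vector_derivative)
  \<comment> \<open>The derivative within the interval is unique because \<open>a < T\<close>, also
    at the endpoints, where it is one-sided.\<close>
  have D': "vector_derivative (\<lambda>s. \<theta> s * bump R (k + 3) x) (at t within {a..T}) = \<theta>' t * bump R (k + 3) x"
    if "t \<in> {a..T}" for t x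
    by (rule vector_derivative_within_closed_interval) (use D[OF that] that assms(2) in auto)
  have "C12 a T (\<lambda>t x. \<theta> t * bump R (k + 3) x)"
    unfolding C12_def
  proof (intro conjI ballI allI)
    show "continuous_on (Q a T) (\<lambda>(t, x). \<theta> t * bump R (k + 3) x)"
      unfolding split_beta by (intro continuous_intros fst \<theta>)
    show "(\<lambda>s. \<theta> s * bump R (k + 3) x) differentiable (at t within {a..T})" if "t \<in> {a..T}" for t x
      using D[OF that] by (rule differentiableI_vector)
    have "continuous_on (Q a T) (\<lambda>(t, x). \<theta>' t * bump R (k + 3) x)"
      unfolding split_beta by (intro continuous_intros fst assms)
    then show "continuous_on (Q a T) (\<lambda>(t, x). vector_derivative (\<lambda>s. \<theta> s * bump R (k + 3) x) (at t within {a..T}))"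
      by (rule continuous_on_cong[THEN iffD1, rotated -1]) (auto simp: D' Q_def)
    show "pdiffable i (\<lambda>x. \<theta> t * bump R (k + 3) x) x" for t i x
      using pderivative_bump(1)[OF assms(1), of i "\<theta> t" "k + 1"] by (simp add: numeral_3_eq_3)
    have eq: "pderivative i (\<lambda>x. \<theta> t * bump R (k + 3) x)
      = (\<lambda>x. \<theta> t * (- (2 * real (k + 3) / R\<^sup>2) * (x $ i * bump R (k + 2) x)))" for i t
    using pderivative_bump(2)[OF assms(1), of i "\<theta> t" "k + 1"] by (simp add: algebra_simps numeral_3_eq_3)
    show "continuous_on (Q a T) (\<lambda>(t, x). pderivative i (\<lambda>x. \<theta> t * bump R (k + 3) x) x)" for i
      unfolding eq split_beta by (intro continuous_intros fst \<theta>)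
    show "pdiffable j (pderivative i (\<lambda>x. \<theta> t * bump R (k + 3) x)) x" for i j t x
      by (rule pderivative_pderivative_bump(1)[OF assms(1)])
    show "continuous_on (Q a T) (\<lambda>(t, x). pderivative j (pderivative i (\<lambda>x. \<theta> t * bump R (k + 3) x)) x)" for i j
      unfolding pderivative_pderivative_bump(2)[OF assms(1)] split_beta
      using assms(1) by (cases "i = j") (auto intro!: continuous_intros fst \<theta>)
  qed
  moreover have "{x. \<exists>t\<in>{a..T}. \<theta> t * bump R (k + 3) x \<noteq> 0} \<subseteq> cball 0 R"
    using bump_eq_0[OF assms(1), of _ "k + 3"] by (force simp: not_le)
  then have "bounded {x. \<exists>t\<in>{a..T}. \<theta> t * bump R (k + 3) x \<noteq> 0}"
    using bounded_cball bounded_subset by blast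
  then have "compact (closure {x. \<exists>t\<in>{a..T}. \<theta> t * bump R (k + 3) x \<noteq> 0})"
    by (simp add: compact_closure)
  ultimately show ?thesis by (simp add: test_functions_def)
qed


section \<open>The fractional integral of the time profile\<close>

text \<open>Substitute \<open>y = ln (s / t) / L\<close> with \<open>L = ln (T / t)\<close>. Then
  \<open>ln (T / s) = L * (1 - y)\<close> and \<open>ds / s = L dy\<close>, so the powers of
  \<open>L\<close> come out and Euler's Beta integral remains. For \<open>t = T\<close> both sides
  are 0.\<close>

lemma lebesgue_integral_ln_powr_mult_ln_power:
  fixes t T \<alpha> :: real
  assumes "0 < t" "t \<le> T" "\<alpha> < 1" "0 < n"
  shows "(LINT s:{t..T}|lebesgue. ln (s / t) powr (- \<alpha>) * ln (T / s) ^ n * (1 / s))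
    = Beta (1 - \<alpha>) (real n + 1) * ln (T / t) powr (real n + 1 - \<alpha>)"
proof (cases "t = T")
  case True
  have "(LINT s:{t..T}|lebesgue. ln (s / t) powr (- \<alpha>) * ln (T / s) ^ n * (1 / s)) = (LINT (s::real)|lebesgue. (0::real))"
    unfolding set_lebesgue_integral_def by (intro Bochner_Integration.integral_cong) (use assms True in \<open>auto simp: indicator_def\<close>)
  then show ?thesis using assms True by simp
next
  case False
  define L where "L = ln (T / t)"
  have L: "L > 0" using assms False by (simp add: L_def)
  define g where "g s = ln (s / t) / L" for s
  define f where "f y = y powr (- \<alpha>) * (1 - y) powr real n" for y :: real
  have gt: "g t = 0" "g T = 1" using assms L by (auto simp: g_def L_def)
  \<comment> \<open>The substitution is carried out over \<open>lborel\<close>; the integrand is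
    Borel measurable, so the completion does not change the integral.\<close>
  have "(LINT s:{t..T}|lebesgue. ln (s / t) powr (- \<alpha>) * ln (T / s) ^ n * (1 / s))
     = (LBINT s. indicator {t..T} s *\<^sub>R (ln (s / t) powr (- \<alpha>) * ln (T / s) ^ n * (1 / s)))"
    unfolding set_lebesgue_integral_def by (rule integral_completion) measurable
  also have "\<dots> = (LBINT s. L powr (real n + 1 - \<alpha>) * (f (g s) * (1 / (s * L)) * indicator {t..T} s))"
  proof (intro Bochner_Integration.integral_cong refl)
    fix s :: real
    show "indicator {t..T} s *\<^sub>R (ln (s / t) powr (- \<alpha>) * ln (T / s) ^ n * (1 / s))
      = L powr (real n + 1 - \<alpha>) * (f (g s) * (1 / (s * L)) * indicator {t..T} s)"
    proof (cases "s \<in> {t..T}")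
      case True
      then have s: "s > 0" "0 \<le> ln (s / t)" "0 \<le> ln (T / s)" using assms by auto
      have 1: "1 - g s = ln (T / s) / L"
        using L s assms by (simp add: g_def L_def field_simps ln_div)
      \<comment> \<open>At \<open>s = T\<close> the base is 0, where \<open>powr\<close> still
        agrees with the natural power because \<open>0 < n\<close>.\<close>
      have "(1 - g s) powr real n = ln (T / s) ^ n / L ^ n"
        unfolding 1 using s L assms by (subst powr_realpow') (auto simp: power_divide)
      moreover have "g s powr (- \<alpha>) = ln (s / t) powr (- \<alpha>) * L powr \<alpha>"
        using s L by (simp add: g_def powr_divide powr_minus field_simps)
      moreover have "L powr (real n + 1 - \<alpha>) = L ^ n * L / L powr \<alpha>"
        using L by (simp add: powr_diff powr_add powr_realpow)
      ultimately show ?thesis using True s L by (simp add: f_def)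
    qed simp
  qed
  also have "\<dots> = L powr (real n + 1 - \<alpha>) * (LBINT s. f (g s) * (1 / (s * L)) * indicator {t..T} s)"
    by (rule integral_mult_right_zero)
  also have "(LBINT s. f (g s) * (1 / (s * L)) * indicator {t..T} s) = (LBINT y. f y * indicator {g t..g T} y)"
  proof (rule integral_substitution(2)[symmetric])
    show "set_integrable lborel {g t..g T} f"
      unfolding gt f_def using integrable_Beta[of "1 - \<alpha>" "real n + 1"] assms by simp
    show "(g has_real_derivative 1 / (s * L)) (at s)" if "s \<in> {t..T}" for s
      unfolding g_def using that assms L by (auto intro!: derivative_eq_intros)
    show "continuous_on {t..T} (\<lambda>s. 1 / (s * L))"
      using assms L by (intro continuous_intros) auto
  qed (use assms L in auto)
  also have "\<dots> = (LBINT y:{0..1}. f y)"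
    by (simp add: gt set_lebesgue_integral_def mult.commute)
  also have "\<dots> = Beta (1 - \<alpha>) (real n + 1)"
  proof -
    have "set_integrable lborel {0..1} f"
      unfolding f_def using integrable_Beta[of "1 - \<alpha>" "real n + 1"] assms by simp
    then have "(LBINT y:{0..1}. f y) = integral {0..1} f"
      by (rule set_borel_integral_eq_integral)
    also have "\<dots> = Beta (1 - \<alpha>) (real n + 1)"
      unfolding f_def using has_integral_Beta_real[of "1 - \<alpha>" "real n + 1"] assms
      by (intro integral_unique) simp
    finally show ?thesis .
  qed
  finally show ?thesis by (simp add: L_def mult.commute)
qed

text \<open>The \<open>1 / s\<close> in the profile cancels the factor \<open>s\<close> introduced
  by \<open>J_test\<close>, which leaves the logarithmic measure \<open>ds / s\<close> of the
  kernel.\<close>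

lemma J_test_power_ln:
  assumes "0 < t" "t \<le> T" "\<alpha> < 1" "0 < n"
  shows "J_test \<alpha> T (\<lambda>s x. (ln (T / s) / S) ^ n / s * g x) t x
    = Beta (1 - \<alpha>) (real n + 1) / Gamma (1 - \<alpha>) / S ^ n * g x * ln (T / t) powr (real n + 1 - \<alpha>)"
proof -
  have "J_test \<alpha> T (\<lambda>s x. (ln (T / s) / S) ^ n / s * g x) t x
     = 1 / Gamma (1 - \<alpha>) * (LINT s:{t..T}|lebesgue. g x / S ^ n * (ln (s / t) powr (- \<alpha>) * ln (T / s) ^ n * (1 / s)))"
    unfolding J_test_def hadamard_J_def set_lebesgue_integral_def
    by (intro arg_cong2[where f="(*)"] refl Bochner_Integration.integral_cong)
       (use assms in \<open>auto simp: indicator_def power_divide\<close>)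
  then show ?thesis
    unfolding set_integral_mult_right lebesgue_integral_ln_powr_mult_ln_power[OF assms] by simp
qed

text \<open>The closed form of \<open>J_test\<close> holds on all of \<open>{a..T}\<close>, so
  differentiating it also gives the one-sided derivative at \<open>a\<close>. With
  \<open>t < T\<close> the base \<open>ln (T / t)\<close> is positive, as the derivative rule for
  \<open>powr\<close> requires.\<close>

lemma dt_J_test_power_ln:
  assumes "0 < a" "a \<le> t" "t < T" "\<alpha> < 1" "0 < n"
  shows "dt_J_test \<alpha> a T (\<lambda>s x. (ln (T / s) / S) ^ n / s * g x) t x
    = - (Beta (1 - \<alpha>) (real n + 1) / Gamma (1 - \<alpha>) * (real n + 1 - \<alpha>) / S ^ n * g x
        * ln (T / t) powr (real n - \<alpha>) / t)"
proof -
  define C where "C = Beta (1 - \<alpha>) (real n + 1) / Gamma (1 - \<alpha>) / S ^ n * g x"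
  have "((\<lambda>s. C * ln (T / s) powr (real n + 1 - \<alpha>)) has_real_derivative
     C * ((real n + 1 - \<alpha>) * ln (T / t) powr (real n + 1 - \<alpha> - 1) * (- 1 / t))) (at t within {a..T})"
    using assms by (intro DERIV_cmult DERIV_chain2[OF has_real_derivative_powr])
      (auto intro!: derivative_eq_intros simp: field_simps power2_eq_square)
  then have "((\<lambda>s. J_test \<alpha> T (\<lambda>s x. (ln (T / s) / S) ^ n / s * g x) s x) has_real_derivative
     C * ((real n + 1 - \<alpha>) * ln (T / t) powr (real n + 1 - \<alpha> - 1) * (- 1 / t))) (at t within {a..T})"
    by (rule has_field_derivative_transform_within[where d=1])
      (use assms in \<open>auto simp only: J_test_power_ln C_def atLeastAtMost_iff\<close>)
  then have "dt_J_test \<alpha> a T (\<lambda>s x. (ln (T / s) / S) ^ n / s * g x) t x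
     = C * ((real n + 1 - \<alpha>) * ln (T / t) powr (real n + 1 - \<alpha> - 1) * (- 1 / t))"
    unfolding dt_J_test_def has_real_derivative_iff_has_vector_derivative
    by (intro vector_derivative_within_closed_interval) (use assms in auto)
  then show ?thesis by (simp add: C_def mult_ac)
qed

section \<open>Integrals and bounds for dominating functions\<close>

text \<open>Since \<open>\<delta> < 1\<close>, the antiderivative
  \<open>ln (t / a) powr (1 - \<delta>) / (1 - \<delta>)\<close> is continuous up to
  \<open>t = a\<close>, so it suffices to differentiate in the interior even if the integrand is
  singular at \<open>a\<close>. Nonnegativity then gives absolute integrability.\<close>

lemma lebesgue_integral_ln_powr:
  fixes a T \<delta> :: real
  assumes "0 < a" "a < T" "\<delta> < 1"
  shows "set_integrable lborel {a..T} (\<lambda>t. ln (t / a) powr (- \<delta>) / t)"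
    and "(LBINT t:{a..T}. ln (t / a) powr (- \<delta>) / t) = ln (T / a) powr (1 - \<delta>) / (1 - \<delta>)"
proof -
  have "((\<lambda>t. ln (t / a) powr (- \<delta>) / t) has_integral
      ln (T / a) powr (1 - \<delta>) / (1 - \<delta>) - ln (a / a) powr (1 - \<delta>) / (1 - \<delta>)) {a..T}"
  proof (rule fundamental_theorem_of_calculus_interior)
    show "continuous_on {a..T} (\<lambda>t. ln (t / a) powr (1 - \<delta>) / (1 - \<delta>))"
      using assms by (intro continuous_intros continuous_on_powr') auto
    show "((\<lambda>t. ln (t / a) powr (1 - \<delta>) / (1 - \<delta>)) has_vector_derivative ln (t / a) powr (- \<delta>) / t) (at t)"
      if "t \<in> {a<..<T}" for t
    proof -
      have "((\<lambda>t. ln (t / a) powr (1 - \<delta>)) has_real_derivative (1 - \<delta>) * ln (t / a) powr (1 - \<delta> - 1) * (1 / t)) (at t)"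
        using that assms by (intro DERIV_chain2[OF has_real_derivative_powr])
          (auto intro!: derivative_eq_intros)
      from DERIV_cdivide[OF this, of "1 - \<delta>"] show ?thesis
        using assms by (simp add: has_real_derivative_iff_has_vector_derivative)
    qed
  qed (use assms in auto)
  then have I: "((\<lambda>t. ln (t / a) powr (- \<delta>) / t) has_integral ln (T / a) powr (1 - \<delta>) / (1 - \<delta>)) {a..T}"
    using assms by simp
  have "(\<lambda>t. ln (t / a) powr (- \<delta>) / t) absolutely_integrable_on {a..T}"
    by (rule nonnegative_absolutely_integrable_1) (use I assms in auto)
  then show *: "set_integrable lborel {a..T} (\<lambda>t. ln (t / a) powr (- \<delta>) / t)"
    unfolding set_integrable_def by (subst (asm) integrable_completion) measurable
  show "(LBINT t:{a..T}. ln (t / a) powr (- \<delta>) / t) = ln (T / a) powr (1 - \<delta>) / (1 - \<delta>)"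
    using set_borel_integral_eq_integral(2)[OF *] integral_unique[OF I] by simp
qed

text \<open>Fubini applies to the product of the two \<open>lborel\<close> measures, which is
  \<open>lborel\<close> on the product type; its completion gives Borel functions the same
  integral.\<close>

lemma lebesgue_integral_product:
  fixes g :: "'a::euclidean_space \<Rightarrow> real" and h :: "'b::euclidean_space \<Rightarrow> real"
  assumes g: "integrable lborel g" and h: "integrable lborel h"
  shows "integrable lebesgue (\<lambda>(t, x). g t * h x)"
    and "(LINT (t, x)|lebesgue. g t * h x) = (LINT t|lborel. g t) * (LINT x|lborel. h x)"
proof -
  have [measurable]: "g \<in> borel_measurable borel" "h \<in> borel_measurable borel"
    using g h by auto
  have *: "integrable (lborel \<Otimes>\<^sub>M lborel) (\<lambda>z. g (fst z) * h (snd z))"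
    using g h by (intro lborel_pair.Fubini_integrable) (auto simp: abs_mult)
  have m: "(\<lambda>z. g (fst z) * h (snd z)) \<in> borel_measurable lborel"
    using borel_measurable_integrable[OF *] by (simp add: lborel_prod)
  show "integrable lebesgue (\<lambda>(t, x). g t * h x)"
    using * m by (simp add: case_prod_beta' integrable_completion lborel_prod)
  have "(LINT t|lborel. (LINT x|lborel. g t * h x)) = integral\<^sup>L (lborel \<Otimes>\<^sub>M lborel) (\<lambda>z. g (fst z) * h (snd z))"
    using lborel_pair.integral_fst'[OF *] by simp
  then show "(LINT (t, x)|lebesgue. g t * h x) = (LINT t|lborel. g t) * (LINT x|lborel. h x)"
    using m by (simp add: case_prod_beta' integral_completion lborel_prod)
qed

text \<open>Measurability of \<open>f\<close> is not assumed: if \<open>f\<close> is not integrable, its integral is \<open>0\<close>.\<close>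

lemma abs_integral_le_integral_AE:
  fixes f :: "'a \<Rightarrow> real"
  assumes "integrable M g" "AE x in M. \<bar>f x\<bar> \<le> g x"
  shows "\<bar>integral\<^sup>L M f\<bar> \<le> integral\<^sup>L M g"
proof (cases "integrable M f")
  case True
  have "\<bar>integral\<^sup>L M f\<bar> \<le> (LINT x|M. \<bar>f x\<bar>)"
    using integral_norm_bound[of M f] by simp
  also have "\<dots> \<le> integral\<^sup>L M g"
    using True assms by (intro integral_mono_AE) auto
  finally show ?thesis .
next
  case False
  have "AE x in M. 0 \<le> g x" using assms(2) by eventually_elim auto
  then show ?thesis using False by (simp add: not_integrable_integral_eq integral_nonneg_AE)
qed

section \<open>Young's inequality and comparison of powers\<close>

text \<open>One of the two terms alone suffices: the first if
  \<open>y \<le> \<epsilon> * x powr (p - 1)\<close>; otherwise \<open>x\<close> is at most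
  \<open>(y / \<epsilon>) powr (1 / (p - 1))\<close> and the second does.\<close>

lemma Young_weighted:
  fixes x y \<epsilon> p :: real
  assumes "0 \<le> x" "0 \<le> y" "0 < \<epsilon>" "1 < p"
  shows "x * y \<le> \<epsilon> * x powr p + \<epsilon> powr (- 1 / (p - 1)) * y powr (p / (p - 1))"
proof (cases "y \<le> \<epsilon> * x powr (p - 1)")
  case True
  then have "x * y \<le> x * (\<epsilon> * x powr (p - 1))" by (rule mult_left_mono) (rule assms)
  also have "\<dots> = \<epsilon> * x powr p"
    using assms powr_mult_base[of x "p - 1"] by simp
  finally show ?thesis by (simp add: add_increasing2)
next
  case False
  have y: "y > 0" using False assms by (smt (verit) mult_nonneg_nonneg powr_ge_zero)
  have "x = (x powr (p - 1)) powr (1 / (p - 1))" using assms by (simp add: powr_powr)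
  also have "\<dots> \<le> (y / \<epsilon>) powr (1 / (p - 1))"
    using False assms by (intro powr_mono2) (auto simp: field_simps)
  also have "\<dots> = \<epsilon> powr (- 1 / (p - 1)) * y powr (1 / (p - 1))"
    using y assms by (simp add: powr_divide powr_minus field_simps)
  finally have "x * y \<le> \<epsilon> powr (- 1 / (p - 1)) * y powr (1 / (p - 1)) * y"
    using y by (intro mult_right_mono) auto
  also have "\<dots> = \<epsilon> powr (- 1 / (p - 1)) * y powr (1 + 1 / (p - 1))"
    using y by (simp add: powr_add)
  also have "1 + 1 / (p - 1) = p / (p - 1)" using assms by (simp add: field_simps)
  finally show ?thesis using assms by (simp add: add_increasing)
qed

text \<open>The weight is split as \<open>w powr (1 / p)\<close> for \<open>A\<close> and
  \<open>w powr (- 1 / p)\<close> for the other factor. The exponent \<open>1 - 1 / p\<close> is the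
  reciprocal of the conjugate exponent \<open>p / (p - 1)\<close>, so exactly \<open>1 / t\<close>
  survives in the last term.\<close>

lemma Young_test_function:
  fixes A w \<phi> t K \<epsilon> p :: real
  assumes "0 \<le> A" "0 < w" "0 \<le> \<phi>" "0 < t" "0 \<le> K" "0 < \<epsilon>" "1 < p"
  shows "A * (K * \<phi> powr (1 / p) * (1 / t) powr (1 - 1 / p))
    \<le> \<epsilon> * (w * A powr p * \<phi>)
      + \<epsilon> powr (- 1 / (p - 1)) * K powr (p / (p - 1)) * (w powr (- 1 / (p - 1)) / t)"
proof -
  define x where "x = w powr (1 / p) * A * \<phi> powr (1 / p)"
  define y where "y = K * w powr (- 1 / p) * (1 / t) powr (1 - 1 / p)"
  have "A * (K * \<phi> powr (1 / p) * (1 / t) powr (1 - 1 / p)) = x * y"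
    using assms by (simp add: x_def y_def powr_minus field_simps)
  moreover have "x powr p = w * A powr p * \<phi>"
    using assms by (simp add: x_def powr_mult powr_powr)
  moreover have "y powr (p / (p - 1)) = K powr (p / (p - 1)) * (w powr (- 1 / (p - 1)) / t)"
  proof -
    have "(1 - 1 / p) * (p / (p - 1)) = 1" using assms by (simp add: field_simps)
    then have "((1 / t) powr (1 - 1 / p)) powr (p / (p - 1)) = 1 / t"
      using assms by (simp only: powr_powr) simp
    moreover have "(w powr (- 1 / p)) powr (p / (p - 1)) = w powr (- 1 / (p - 1))"
      using assms by (simp add: powr_powr)
    ultimately show ?thesis using assms by (simp add: y_def powr_mult)
  qed
  moreover have "x * y \<le> \<epsilon> * x powr p + \<epsilon> powr (- 1 / (p - 1)) * y powr (p / (p - 1))"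
    using assms by (intro Young_weighted) (auto simp: x_def y_def)
  ultimately show ?thesis by (simp add: mult.assoc)
qed

text \<open>On \<open>[0, 1]\<close> powers decrease in the exponent, and \<open>0 powr r\<close> is
  0. This compares a power lowered by differentiation with the \<open>p\<close>-th root of the
  original one.\<close>

lemma powr_le_power_powr:
  fixes y r p :: real
  assumes "0 \<le> y" "y \<le> 1" "real k / p \<le> r"
  shows "y powr r \<le> (y ^ k) powr (1 / p)"
proof (cases "y = 0")
  case False
  then have "(y ^ k) powr (1 / p) = y powr (real k / p)"
    using assms by (simp add: powr_powr flip: powr_realpow)
  then show ?thesis using assms by (simp add: powr_mono')
qed simp

lemma power_le_power_powr:
  fixes y p :: real
  assumes "0 \<le> y" "y \<le> 1" "real k / p \<le> real j" "0 < j"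
  shows "y ^ j \<le> (y ^ k) powr (1 / p)"
  using powr_le_power_powr[OF assms(1-3)] assms by (simp add: powr_realpow')

section \<open>Null time slices, exhaustion by bumps, admissible test functions and growth\<close>

text \<open>The slice is a hyperplane, hence negligible. It allows the initial and the final time to
  be left out of pointwise bounds.\<close>

lemma AE_fst_neq: "AE z in lebesgue. fst (z :: real \<times> 'a::euclidean_space) \<noteq> c"
proof -
  have "negligible {z :: real \<times> 'a. (1, 0) \<bullet> z = c}"
    by (rule negligible_hyperplane) (simp add: zero_prod_def)
  moreover have "{z :: real \<times> 'a. (1, 0) \<bullet> z = c} = {z. fst z = c}"
    by (auto simp: inner_prod_def)
  ultimately show ?thesis
    by (intro AE_I'[of "{z. fst z = c}"]) (auto simp: negligible_iff_null_sets)
qed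

text \<open>The bumps of radius 1, 2, ... lie between 0 and 1 and tend to 1 pointwise. Dominated
  convergence with bound \<open>\<bar>F x\<bar>\<close> then carries strict positivity over to some
  finite radius.\<close>

lemma exists_bump_integral_pos:
  fixes F :: "real^'n \<Rightarrow> real"
  assumes F: "integrable lebesgue F" and pos: "l * (LINT x|lebesgue. F x) > 0"
  shows "\<exists>R>0. l * (LINT x|lebesgue. F x * bump R k x) > 0"
proof -
  have "(\<lambda>i. LINT x|lebesgue. F x * bump (real (Suc i)) k x) \<longlonglongrightarrow> (LINT x|lebesgue. F x)"
  proof (rule integral_dominated_convergence[where w="\<lambda>x. \<bar>F x\<bar>"])
    show "(\<lambda>x. F x * bump (real (Suc i)) k x) \<in> borel_measurable lebesgue" for i
    proof -
      have "bump (real (Suc i)) k \<in> borel_measurable (lborel :: (real^'n) measure)"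
        using continuous_bump[OF continuous_on_id, of UNIV] by (auto intro: borel_measurable_continuous_onI)
      then show ?thesis
        by (intro borel_measurable_times borel_measurable_integrable[OF F] measurable_completion)
    qed
    show "AE x in lebesgue. (\<lambda>i. F x * bump (real (Suc i)) k x) \<longlonglongrightarrow> F x"
    proof (intro AE_I2)
      fix x :: "real^'n"
      have "(\<lambda>i. (x \<bullet> x) * inverse (real (Suc i)) ^ 2) \<longlonglongrightarrow> (x \<bullet> x) * 0 ^ 2"
        by (intro tendsto_intros LIMSEQ_inverse_real_of_nat)
      then have "(\<lambda>i. (x \<bullet> x) / (real (Suc i))\<^sup>2) \<longlonglongrightarrow> 0"
        by (simp add: divide_inverse power_inverse)
      then have "(\<lambda>i. F x * max 0 (1 - (x \<bullet> x) / (real (Suc i))\<^sup>2) ^ k) \<longlonglongrightarrow> F x * max 0 (1 - 0) ^ k"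
        by (intro tendsto_intros)
      then show "(\<lambda>i. F x * bump (real (Suc i)) k x) \<longlonglongrightarrow> F x"
        by (simp add: bump_def)
    qed
    show "AE x in lebesgue. norm (F x * bump (real (Suc i)) k x) \<le> \<bar>F x\<bar>" for i
      by (intro AE_I2) (simp add: abs_mult bump_nonneg bump_le_1 mult_left_le)
  qed (use F in auto)
  then have "(\<lambda>i. l * (LINT x|lebesgue. F x * bump (real (Suc i)) k x)) \<longlonglongrightarrow> l * (LINT x|lebesgue. F x)"
    by (intro tendsto_intros)
  from order_tendstoD(1)[OF this pos] have "\<exists>i. 0 < l * (LINT x|lebesgue. F x * bump (real (Suc i)) k x)"
    by (auto dest: eventually_happens)
  then show ?thesis by (metis of_nat_0_less_iff zero_less_Suc)
qed


lemma power_ln_bump_in_test_functions: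
  assumes "0 < a" "a < T" "0 < R" "S = ln (T / a)"
  shows "(\<lambda>t x. (ln (T / t) / S) ^ n / t * bump R (m + 3) x) \<in> test_functions a T"
proof (rule product_bump_in_test_functions)
  have S: "S > 0" using assms by simp
  \<comment> \<open>For \<open>n = 0\<close> the truncated exponent \<open>n - 1\<close> is
    harmless, as its coefficient \<open>real n\<close> vanishes.\<close>
  show "((\<lambda>t. (ln (T / t) / S) ^ n / t) has_real_derivative
      (real n * (ln (T / t) / S) ^ (n - 1) * (- 1 / (t * S)) * t - (ln (T / t) / S) ^ n) / t\<^sup>2) (at t within {a..T})"
    if "t \<in> {a..T}" for t
  proof -
    have "((\<lambda>t. ln (T / t) / S) has_real_derivative - 1 / (t * S)) (at t within {a..T})"
      using that assms S by (auto intro!: derivative_eq_intros simp: field_simps power2_eq_square)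
    from DERIV_divide[OF DERIV_power[OF this, of n] DERIV_ident] that assms
    show ?thesis by (auto simp: power2_eq_square mult_ac)
  qed
  show "continuous_on {a..T} (\<lambda>t. (real n * (ln (T / t) / S) ^ (n - 1) * (- 1 / (t * S)) * t - (ln (T / t) / S) ^ n) / t\<^sup>2)"
    using assms S by (intro continuous_intros) auto
qed (use assms in auto)

text \<open>The choice of \<open>m\<close> lets the bump lose two powers and stay below its own
  \<open>p\<close>-th root; \<open>n\<close> does the same for the time profile, which loses
  \<open>\<alpha>\<close> powers. Large values work because \<open>1 / p < 1\<close>.\<close>

lemma exists_large_nat:
  fixes \<alpha> p :: real
  assumes "1 < p"
  obtains m n :: nat where "real (m + 3) / p \<le> real (m + 1)" "0 < n" "real n / p \<le> real n - \<alpha>" "\<alpha> < real n"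
proof -
  obtain m :: nat where m: "3 / (p - 1) \<le> real m" using real_arch_simple by blast
  obtain n :: nat where n: "max (\<alpha> * p / (p - 1)) (\<bar>\<alpha>\<bar> + 1) \<le> real n" using real_arch_simple by blast
  show ?thesis
  proof
    show "real (m + 3) / p \<le> real (m + 1)" using m assms by (simp add: field_simps)
    show "real n / p \<le> real n - \<alpha>" using n assms by (simp add: field_simps)
  qed (use n in auto)
qed

text \<open>\<open>Q a T\<close> is unbounded in space, but on it the product vanishes outside the
  compact set \<open>{a..T} \<times> cball 0 R\<close>, where \<open>g\<close> is absolutely
  integrable and \<open>\<phi>\<close> is continuous and bounded.\<close>

lemma set_integrable_weight_test_function:
  fixes g :: "real \<times> (real^'n) \<Rightarrow> real" and \<phi> :: "real \<Rightarrow> real^'n \<Rightarrow> real"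
  assumes g: "L1_loc ({a..} \<times> UNIV) g" and \<phi>: "continuous_on (Q a T) (\<lambda>(t, x). \<phi> t x)"
    and 0: "\<And>t x. R < norm x \<Longrightarrow> \<phi> t x = 0"
  shows "set_integrable lebesgue (Q a T) (\<lambda>(t, x). g (t, x) * \<phi> t x)"
proof -
  let ?K = "{a..T} \<times> cball (0 :: real^'n) R"
  have K: "compact ?K" by (intro compact_Times) auto
  then have Km: "?K \<in> sets lebesgue"
    by (metis compact_imp_closed borel_closed sets_completionI_sets sets_lborel)
  have c: "continuous_on ?K (\<lambda>(t, x). \<phi> t x)"
    by (rule continuous_on_subset[OF \<phi>]) (auto simp: Q_def)
  have "(\<lambda>z. (case z of (t, x) \<Rightarrow> \<phi> t x) * g z) absolutely_integrable_on ?K"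
  proof (rule absolutely_integrable_bounded_measurable_product[OF bilinear_times])
    show "(\<lambda>(t, x). \<phi> t x) \<in> borel_measurable (lebesgue_on ?K)"
      using c Km by (rule continuous_imp_measurable_on_sets_lebesgue)
    show "bounded ((\<lambda>(t, x). \<phi> t x) ` ?K)"
      using compact_continuous_image[OF c K] by (rule compact_imp_bounded)
    show "g absolutely_integrable_on ?K"
      using g K unfolding L1_loc_def by auto
  qed (rule Km)
  moreover have "indicator (Q a T) z *\<^sub>R (case z of (t, x) \<Rightarrow> g (t, x) * \<phi> t x)
     = indicator ?K z *\<^sub>R ((case z of (t, x) \<Rightarrow> \<phi> t x) * g z)" for z
    using 0[of "snd z" "fst z"] by (cases z) (auto simp: indicator_def Q_def not_le)
  ultimately show ?thesis by (simp add: set_integrable_def)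
qed

text \<open>Dividing by \<open>S powr (1 - \<delta>)\<close> would bound
  \<open>S powr (\<delta> - \<alpha>)\<close>, which tends to infinity.\<close>

lemma scaling_contradiction:
  fixes c M \<alpha> \<delta> :: real
  assumes "0 < c" "\<alpha> < \<delta>" and le: "\<And>S. 1 \<le> S \<Longrightarrow> c * S powr (1 - \<alpha>) \<le> M * S powr (1 - \<delta>)"
  shows False
proof -
  have "filterlim (\<lambda>S::real. S powr (\<delta> - \<alpha>)) at_top at_top"
    using assms by (real_asymp)
  then have "\<forall>\<^sub>F S in at_top. M / c < (S::real) powr (\<delta> - \<alpha>)"
    by (simp add: filterlim_at_top_dense)
  with eventually_ge_at_top[of "1::real"]
  have "\<forall>\<^sub>F S in at_top. 1 \<le> S \<and> M / c < (S::real) powr (\<delta> - \<alpha>)"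
    by eventually_elim auto
  then obtain S :: real where S: "1 \<le> S" "M / c < S powr (\<delta> - \<alpha>)"
    using eventually_happens by force
  have "S powr (1 - \<alpha>) = S powr (\<delta> - \<alpha>) * S powr (1 - \<delta>)"
    by (simp flip: powr_add)
  with le[OF S(1)] S have "c * S powr (\<delta> - \<alpha>) \<le> M" by simp
  with S(2) assms(1) show False by (simp add: field_simps)
qed

section \<open>The estimate for a single real equation\<close>

text \<open>The real and the imaginary equation share this form: \<open>A\<close> is the modulus of
  \<open>u\<close>, \<open>v1\<close> its real or imaginary part, \<open>v2\<close> the rotated
  combination, and \<open>l\<close> the corresponding part of \<open>lam\<close>, of either sign. Of
  \<open>v1\<close> and \<open>v2\<close> only the bounds by \<open>2 * A\<close> enter.\<close>

lemma no_weak_solution_component: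
  fixes F :: "real^'n \<Rightarrow> real" and A v1 v2 :: "real \<Rightarrow> real^'n \<Rightarrow> real" and a \<alpha> \<gamma> p l :: real
  assumes "0 < a" "0 < \<alpha>" "\<alpha> < 1" "0 < \<gamma>" "1 + \<gamma> < p" "p < 1 + \<gamma> / \<alpha>"
    and A: "L1_loc ({a..} \<times> UNIV) (\<lambda>(t, x). ln (t / a) powr \<gamma> * A t x powr p)"
    and v1: "\<And>t x. \<bar>v1 t x\<bar> \<le> 2 * A t x" and v2: "\<And>t x. \<bar>v2 t x\<bar> \<le> 2 * A t x"
    and weak: "\<And>T \<phi>. a < T \<Longrightarrow> \<phi> \<in> test_functions a T \<Longrightarrow>
       l * (LINT (t, x):Q a T|lebesgue. ln (t / a) powr \<gamma> * A t x powr p * \<phi> t x)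
         + (LINT x|lebesgue. F x * J_test \<alpha> T \<phi> a x)
       = (LINT (t, x):Q a T|lebesgue. v1 t x * laplacian (\<phi> t) x)
         - (LINT (t, x):Q a T|lebesgue. v2 t x * dt_J_test \<alpha> a T \<phi> t x)"
    and F: "integrable lebesgue F" and pos: "l * (LINT x|lebesgue. F x) > 0"
  shows False
proof -
  have p: "1 < p" using assms by linarith
  have A0: "0 \<le> A t x" for t x using v1[of t x] by linarith
  \<comment> \<open>This is the exponent that Young's inequality leaves on the logarithm: \<open>(ln
    (t / a) powr \<gamma>) powr (- 1 / (p - 1)) = ln (t / a) powr (- \<delta>)\<close>.\<close>
  define \<delta> where "\<delta> = \<gamma> / (p - 1)"
  have \<delta>: "\<alpha> < \<delta>" "\<delta> < 1" using assms p by (auto simp: \<delta>_def field_simps)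
  obtain m n where m: "real (m + 3) / p \<le> real (m + 1)"
    and n: "0 < n" "real n / p \<le> real n - \<alpha>" "\<alpha> < real n"
    using exists_large_nat[OF p] .
  obtain R where R: "R > 0" and FF_pos: "l * (LINT x|lebesgue. F x * bump R (m + 3) x) > 0"
    using exists_bump_integral_pos[OF F pos] by blast
  define FF where "FF = (LINT x|lebesgue. F x * bump R (m + 3) x)"
  have FF: "l * FF > 0" using FF_pos by (simp add: FF_def)
  then have l: "l \<noteq> 0" by auto
  define c where "c = Beta (1 - \<alpha>) (real n + 1) / Gamma (1 - \<alpha>)"
  have "Gamma (1 - \<alpha>) > 0" using assms by (intro Gamma_real_pos) simp
  moreover have "Beta (1 - \<alpha>) (real n + 1) > 0"
    using assms unfolding Beta_def by (intro divide_pos_pos mult_pos_pos Gamma_real_pos) auto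
  ultimately have c: "c > 0" by (simp add: c_def)
  define K1 where "K1 = real CARD('n) * (2 * real (m + 3) / R\<^sup>2 * (1 + 2 * real (m + 2)))"
  \<comment> \<open>The sum of the two derivative constants serves both integrals; the factor 2
    comes from the bounds on \<open>v1\<close> and \<open>v2\<close>. Nothing here depends on
    \<open>T\<close>.\<close>
  define K where "K = 2 * (K1 + c * (real n + 1 - \<alpha>))"
  have K1: "K1 \<ge> 0" by (simp add: K1_def)
  have K2: "c * (real n + 1 - \<alpha>) \<ge> 0" using c assms by simp
  have K: "K \<ge> 0" using K1 K2 by (simp add: K_def)
  \<comment> \<open>Young's constant for \<open>\<epsilon> = \<bar>l\<bar> / 2\<close>: each of the
    two integrals may consume half of the nonlinear term.\<close>
  define C where "C = (\<bar>l\<bar> / 2) powr (- 1 / (p - 1)) * K powr (p / (p - 1))"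
  define V where "V = measure lborel (cball (0 :: real^'n) R)"
  have "c * \<bar>FF\<bar> * S powr (1 - \<alpha>) \<le> 2 * C * V / (1 - \<delta>) * S powr (1 - \<delta>)" if S: "1 \<le> S" for S
  proof -
    define T where "T = a * exp S"
    have T: "a < T" "ln (T / a) = S" using assms(1) S by (auto simp: T_def)
    define \<phi> where "\<phi> t x = (ln (T / t) / S) ^ n / t * bump R (m + 3) x" for t and x :: "real^'n"
    have \<phi>: "\<phi> \<in> test_functions a T"
      unfolding \<phi>_def[abs_def] using assms(1) T R by (intro power_ln_bump_in_test_functions) auto
    have \<phi>0: "\<phi> t x = 0" if "R < norm x" for t x
      using bump_eq_0[OF R that] by (simp add: \<phi>_def)
    have \<eta>: "0 \<le> ln (T / t) / S" "ln (T / t) / S \<le> 1" if "t \<in> {a..T}" for t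
    proof -
      have "ln (T / t) \<le> ln (T / a)"
        using that assms(1) T by (intro ln_mono frac_le) auto
      then show "ln (T / t) / S \<le> 1" using S T by simp
      show "0 \<le> ln (T / t) / S" using that assms(1) S by simp
    qed
    have \<phi>_nonneg: "0 \<le> \<phi> t x" if "t \<in> {a..T}" for t x
      unfolding \<phi>_def
      using that assms(1) by (intro mult_nonneg_nonneg divide_nonneg_nonneg zero_le_power bump_nonneg \<eta>) auto
    have t_split: "1 / t = (1 / t) powr (1 / p) * (1 / t) powr (1 - 1 / p)" if "t > 0" for t
      using that by (simp flip: powr_add)
    \<comment> \<open>Here \<open>h\<close> and \<open>b\<close> are what differentiation leaves of
      the time profile and of the bump. One part of \<open>1 / t\<close> completes
      \<open>\<phi>\<close> under the \<open>p\<close>-th root, the other is kept for Young's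
      inequality.\<close>
    have core: "h * (1 / t) * b \<le> \<phi> t x powr (1 / p) * (1 / t) powr (1 - 1 / p)"
      if "t \<in> {a..T}" "h \<le> ((ln (T / t) / S) ^ n) powr (1 / p)" "0 \<le> b" "b \<le> bump R (m + 3) x powr (1 / p)"
      for t x h b
    proof -
      have t: "t > 0" using that assms(1) by auto
      have "h * b \<le> ((ln (T / t) / S) ^ n) powr (1 / p) * bump R (m + 3) x powr (1 / p)"
        using that by (intro mult_mono) auto
      then have "h * b * ((1 / t) powr (1 / p) * (1 / t) powr (1 - 1 / p))
        \<le> ((ln (T / t) / S) ^ n) powr (1 / p) * bump R (m + 3) x powr (1 / p)
          * ((1 / t) powr (1 / p) * (1 / t) powr (1 - 1 / p))"
        by (rule mult_right_mono) simp
      also have "\<dots> = ((ln (T / t) / S) ^ n * (1 / t) * bump R (m + 3) x) powr (1 / p) * (1 / t) powr (1 - 1 / p)"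
        by (simp only: powr_mult mult_ac)
      finally show ?thesis unfolding t_split[OF t, symmetric] by (simp add: \<phi>_def mult_ac)
    qed
    have bump1: "bump R (m + 1) x \<le> bump R (m + 3) x powr (1 / p)" for x :: "real^'n"
      unfolding bump_def by (rule power_le_power_powr[OF _ _ m]) auto
    have bump3: "bump R (m + 3) x \<le> bump R (m + 3) x powr (1 / p)" for x :: "real^'n"
      using bump_antimono[of "m + 1" "m + 3" R x] bump1[of x] by linarith
    have lap: "\<bar>laplacian (\<phi> t) x\<bar> \<le> K1 * (\<phi> t x powr (1 / p) * (1 / t) powr (1 - 1 / p))"
      if t: "t \<in> {a..T}" for t x
    proof -
      have "real n / p \<le> real n" using n assms by linarith
      then have "(ln (T / t) / S) ^ n * (1 / t) * bump R (m + 1) x \<le> \<phi> t x powr (1 / p) * (1 / t) powr (1 - 1 / p)"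
        using t by (intro core bump_nonneg bump1 power_le_power_powr \<eta> n)
      then have "K1 * ((ln (T / t) / S) ^ n * (1 / t) * bump R (m + 1) x)
           \<le> K1 * (\<phi> t x powr (1 / p) * (1 / t) powr (1 - 1 / p))"
        using K1 by (rule mult_left_mono)
      moreover have "\<bar>(ln (T / t) / S) ^ n / t\<bar> = (ln (T / t) / S) ^ n * (1 / t)"
        using \<eta>[OF t] t assms(1) by simp
      ultimately show ?thesis
        using abs_laplacian_bump_le[OF R, of "(ln (T / t) / S) ^ n / t" m x]
        unfolding \<phi>_def[abs_def] K1_def by (simp only:)
    qed
    have dtJ: "\<bar>dt_J_test \<alpha> a T \<phi> t x\<bar> \<le> c * (real n + 1 - \<alpha>) * (\<phi> t x powr (1 / p) * (1 / t) powr (1 - 1 / p))"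
      if t: "t \<in> {a..<T}" for t x
    proof -
      have t0: "t > 0" and L: "ln (T / t) > 0" using t assms(1) by auto
      have "ln (T / t) powr (real n - \<alpha>) = (ln (T / t) / S) powr (real n - \<alpha>) * S powr (real n - \<alpha>)"
        using L S by (simp add: powr_divide)
      \<comment> \<open>\<open>S \<ge> 1\<close> permits raising the exponent from
        \<open>n - \<alpha>\<close> to \<open>n\<close>, which keeps the constant independent of
        \<open>S\<close>.\<close>
      also have "\<dots> \<le> (ln (T / t) / S) powr (real n - \<alpha>) * S ^ n"
        using S assms powr_mono[of "real n - \<alpha>" "real n" S] by (intro mult_left_mono) (auto simp: powr_realpow)
      finally have "ln (T / t) powr (real n - \<alpha>) / S ^ n \<le> (ln (T / t) / S) powr (real n - \<alpha>)"
        using S by (simp add: field_simps)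
      also have "\<dots> \<le> ((ln (T / t) / S) ^ n) powr (1 / p)"
        using t by (intro powr_le_power_powr \<eta> n) auto
      finally have "ln (T / t) powr (real n - \<alpha>) / S ^ n * (1 / t) * bump R (m + 3) x
          \<le> \<phi> t x powr (1 / p) * (1 / t) powr (1 - 1 / p)"
        using t by (intro core bump_nonneg bump3) auto
      then have "c * (real n + 1 - \<alpha>) * (ln (T / t) powr (real n - \<alpha>) / S ^ n * (1 / t) * bump R (m + 3) x)
          \<le> c * (real n + 1 - \<alpha>) * (\<phi> t x powr (1 / p) * (1 / t) powr (1 - 1 / p))"
        using K2 by (rule mult_left_mono)
      moreover have "\<bar>dt_J_test \<alpha> a T \<phi> t x\<bar>
          = c * (real n + 1 - \<alpha>) * (ln (T / t) powr (real n - \<alpha>) / S ^ n * (1 / t) * bump R (m + 3) x)"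
      proof -
        have "dt_J_test \<alpha> a T \<phi> t x = - (c * (real n + 1 - \<alpha>) * (ln (T / t) powr (real n - \<alpha>) / S ^ n * (1 / t) * bump R (m + 3) x))"
          unfolding \<phi>_def[abs_def] c_def using t assms n by (subst dt_J_test_power_ln) (auto simp: mult_ac)
        moreover have "0 \<le> c * (real n + 1 - \<alpha>) * (ln (T / t) powr (real n - \<alpha>) / S ^ n * (1 / t) * bump R (m + 3) x)"
          using K2 S t0 by (intro mult_nonneg_nonneg[OF K2]) (auto simp: bump_nonneg)
        ultimately show ?thesis by linarith
      qed
      ultimately show ?thesis by simp
    qed
    define w where "w t = ln (t / a) powr \<gamma>" for t
    define I where "I = (LINT (t, x):Q a T|lebesgue. w t * A t x powr p * \<phi> t x)"
    define g where "g t = indicator {a..T} t *\<^sub>R (ln (t / a) powr (- \<delta>) / t)" for t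
    \<comment> \<open>A single dominating function for both integrals: half of the nonlinear term
      plus an explicit remainder of product form.\<close>
    define G where "G z = \<bar>l\<bar> / 2 * (indicator (Q a T) z *\<^sub>R (case z of (t, x) \<Rightarrow> w t * A t x powr p * \<phi> t x))
      + C * (case z of (t, x) \<Rightarrow> g t * indicator (cball 0 R) x)" for z :: "real \<times> (real^'n)"
    have int1: "set_integrable lebesgue (Q a T) (\<lambda>(t, x). w t * A t x powr p * \<phi> t x)"
      using set_integrable_weight_test_function[OF A, of T \<phi> R] \<phi> \<phi>0
      by (simp add: w_def test_functions_def C12_def)
    have gi: "integrable lborel g" and g: "(LINT t|lborel. g t) = S powr (1 - \<delta>) / (1 - \<delta>)"
      using lebesgue_integral_ln_powr[OF assms(1) T(1) \<delta>(2)] T(2)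
      unfolding g_def[abs_def] set_integrable_def set_lebesgue_integral_def by auto
    have hi: "integrable lborel (indicator (cball (0 :: real^'n) R) :: _ \<Rightarrow> real)"
      using emeasure_bounded_finite[OF bounded_cball, of "0 :: real^'n" R]
      by (simp add: integrable_indicator_iff)
    have Gi: "integrable lebesgue G"
      unfolding G_def[abs_def] using int1 lebesgue_integral_product(1)[OF gi hi]
      by (auto simp: set_integrable_def)
    have GI: "integral\<^sup>L lebesgue G = \<bar>l\<bar> / 2 * I + C * V / (1 - \<delta>) * S powr (1 - \<delta>)"
      unfolding G_def[abs_def] I_def set_lebesgue_integral_def
      using int1 lebesgue_integral_product[OF gi hi] g by (simp add: set_integrable_def V_def)
    \<comment> \<open>Strictness of \<open>a < t\<close> makes the weight \<open>w t\<close>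
      positive, as Young's inequality requires. Outside the ball \<open>\<phi>\<close> vanishes and
      forces \<open>D = 0\<close>.\<close>
    have bound: "\<bar>v * D\<bar> \<le> G (t, x)"
      if t: "a < t" "t \<le> T" and v: "\<bar>v\<bar> \<le> 2 * A t x"
        and D: "\<bar>D\<bar> \<le> K / 2 * (\<phi> t x powr (1 / p) * (1 / t) powr (1 - 1 / p))" for v D t x
    proof (cases "norm x \<le> R")
      case True
      have "\<bar>v * D\<bar> \<le> 2 * A t x * (K / 2 * (\<phi> t x powr (1 / p) * (1 / t) powr (1 - 1 / p)))"
        unfolding abs_mult using v D A0[of t x] by (intro mult_mono) auto
      also have "\<dots> = A t x * (K * \<phi> t x powr (1 / p) * (1 / t) powr (1 - 1 / p))"
        by simp
      also have "\<dots> \<le> \<bar>l\<bar> / 2 * (w t * A t x powr p * \<phi> t x) + C * (w t powr (- 1 / (p - 1)) / t)"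
        unfolding C_def
        using t assms(1) l p by (intro Young_test_function A0 \<phi>_nonneg K) (auto simp: w_def)
      also have "w t powr (- 1 / (p - 1)) = ln (t / a) powr (- \<delta>)"
        by (simp add: w_def powr_powr \<delta>_def)
      finally show ?thesis using t True by (simp add: G_def g_def Q_def)
    next
      case False
      then have "D = 0" using D \<phi>0[of x t] by simp
      then show ?thesis using False \<phi>0[of x t] by (simp add: G_def)
    qed
    have AE: "AE z in lebesgue. fst (z :: real \<times> (real^'n)) \<noteq> a \<and> fst z \<noteq> T"
      using AE_fst_neq[of a] AE_fst_neq[of T] by eventually_elim auto
    have G0: "0 \<le> G z" if "fst z \<notin> {a..T}" for z
      using that by (cases z) (auto simp: G_def g_def Q_def)
    have B1: "\<bar>LINT (t, x):Q a T|lebesgue. v1 t x * laplacian (\<phi> t) x\<bar> \<le> integral\<^sup>L lebesgue G"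
      unfolding set_lebesgue_integral_def
    proof (rule abs_integral_le_integral_AE[OF Gi], use AE in eventually_elim)
      fix z :: "real \<times> (real^'n)" assume z: "fst z \<noteq> a \<and> fst z \<noteq> T"
      obtain t x where zt: "z = (t, x)" by fastforce
      have "K1 * (\<phi> t x powr (1 / p) * (1 / t) powr (1 - 1 / p)) \<le> K / 2 * (\<phi> t x powr (1 / p) * (1 / t) powr (1 - 1 / p))"
        using K2 by (intro mult_right_mono) (auto simp: K_def)
      then show "\<bar>indicat_real (Q a T) z *\<^sub>R (case z of (t, x) \<Rightarrow> v1 t x * laplacian (\<phi> t) x)\<bar> \<le> G z"
        using z G0[of z] v1[of t x] lap[of t x] bound[of t "v1 t x" x "laplacian (\<phi> t) x"]
        by (cases "t \<in> {a..T}") (auto simp: zt Q_def)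
    qed
    have B2: "\<bar>LINT (t, x):Q a T|lebesgue. v2 t x * dt_J_test \<alpha> a T \<phi> t x\<bar> \<le> integral\<^sup>L lebesgue G"
      unfolding set_lebesgue_integral_def
    proof (rule abs_integral_le_integral_AE[OF Gi], use AE in eventually_elim)
      fix z :: "real \<times> (real^'n)" assume z: "fst z \<noteq> a \<and> fst z \<noteq> T"
      obtain t x where zt: "z = (t, x)" by fastforce
      have "c * (real n + 1 - \<alpha>) * (\<phi> t x powr (1 / p) * (1 / t) powr (1 - 1 / p)) \<le> K / 2 * (\<phi> t x powr (1 / p) * (1 / t) powr (1 - 1 / p))"
        using K1 by (intro mult_right_mono) (auto simp: K_def)
      then show "\<bar>indicat_real (Q a T) z *\<^sub>R (case z of (t, x) \<Rightarrow> v2 t x * dt_J_test \<alpha> a T \<phi> t x)\<bar> \<le> G z"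
        using z G0[of z] v2[of t x] dtJ[of t x] bound[of t "v2 t x" x "dt_J_test \<alpha> a T \<phi> t x"]
        by (cases "t \<in> {a..T}") (auto simp: zt Q_def)
    qed
    have J: "(LINT x|lebesgue. F x * J_test \<alpha> T \<phi> a x) = c * S powr (1 - \<alpha>) * FF"
    proof -
      have "J_test \<alpha> T \<phi> a x = c * S powr (1 - \<alpha>) * bump R (m + 3) x" for x
      proof -
        \<comment> \<open>The factor \<open>S ^ n\<close> cancels the normalisation of the
          profile.\<close>
        have "S powr (real n + 1 - \<alpha>) = S ^ n * S powr (1 - \<alpha>)"
          using S by (simp flip: powr_realpow powr_add add: algebra_simps)
        then show ?thesis
          unfolding \<phi>_def[abs_def] c_def using assms T n S by (subst J_test_power_ln) auto
      qed
      then have "(LINT x|lebesgue. F x * J_test \<alpha> T \<phi> a x) = (LINT x|lebesgue. c * S powr (1 - \<alpha>) * (F x * bump R (m + 3) x))"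
        by (simp add: mult_ac)
      then show ?thesis unfolding FF_def by (simp only: integral_mult_right_zero)
    qed
    have eq: "l * I + c * S powr (1 - \<alpha>) * FF
      = (LINT (t, x):Q a T|lebesgue. v1 t x * laplacian (\<phi> t) x)
         - (LINT (t, x):Q a T|lebesgue. v2 t x * dt_J_test \<alpha> a T \<phi> t x)"
      using weak[OF T(1) \<phi>] unfolding J I_def w_def .
    \<comment> \<open>Two copies of the integral of \<open>G\<close> contain exactly
      \<open>\<bar>l\<bar> * I\<close>, which cancels against the lower bound below.\<close>
    have "\<bar>l * I + c * S powr (1 - \<alpha>) * FF\<bar> \<le> 2 * integral\<^sup>L lebesgue G"
      using B1 B2 unfolding eq by linarith
    then have "\<bar>l * I + c * S powr (1 - \<alpha>) * FF\<bar> \<le> \<bar>l\<bar> * I + 2 * C * V / (1 - \<delta>) * S powr (1 - \<delta>)"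
      by (simp add: GI algebra_simps)
    \<comment> \<open>\<open>l\<close> and \<open>FF\<close> have the same sign, so the left side is
      plus or minus the expression inside the absolute value.\<close>
    moreover have "\<bar>l\<bar> * I + c * S powr (1 - \<alpha>) * \<bar>FF\<bar> \<le> \<bar>l * I + c * S powr (1 - \<alpha>) * FF\<bar>"
    proof (cases "l > 0")
      case True
      then have "FF > 0" using FF by (simp add: zero_less_mult_iff)
      then show ?thesis using True by simp
    next
      case False
      then have "FF < 0" "l < 0" using FF by (auto simp: zero_less_mult_iff)
      then show ?thesis by simp
    qed
    ultimately show ?thesis by (simp add: mult_ac)
  qed
  moreover have "c * \<bar>FF\<bar> > 0" using c FF by (cases "FF = 0") auto
  ultimately show False by (rule scaling_contradiction[OF _ \<delta>(1), rotated])
qed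

section \<open>Passage to the complex equation\<close>

lemma abs_component_combination_le:
  fixes z :: complex
  shows "\<bar>cos b * Re z - sin b * Im z\<bar> \<le> 2 * norm z" "\<bar>sin b * Re z + cos b * Im z\<bar> \<le> 2 * norm z"
proof -
  have *: "\<bar>u * Re z\<bar> \<le> norm z" "\<bar>u * Im z\<bar> \<le> norm z" if "\<bar>u\<bar> \<le> 1" for u :: real
    using mult_mono[OF that abs_Re_le_cmod[of z]] mult_mono[OF that abs_Im_le_cmod[of z]]
    by (auto simp: abs_mult)
  show "\<bar>cos b * Re z - sin b * Im z\<bar> \<le> 2 * norm z" "\<bar>sin b * Re z + cos b * Im z\<bar> \<le> 2 * norm z"
    using *[of "cos b"] *[of "sin b"] by auto
qed

theorem theorem2:
  fixes a \<alpha> \<gamma> p :: real and lam :: complex and f :: "real^'n \<Rightarrow> complex"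
  assumes "a > 0" and "0 < \<alpha>" and "\<alpha> < 1" and "lam \<noteq> 0" and "\<gamma> > 0"
    and "1 + \<gamma> < p" and "p < 1 + \<gamma> / \<alpha>"
    and "integrable lebesgue f"
    and "Re lam * (LINT x|lebesgue.
             cos (pi * \<alpha> / 2) * Re (f x) - sin (pi * \<alpha> / 2) * Im (f x)) > 0
       \<or> Im lam * (LINT x|lebesgue.
             sin (pi * \<alpha> / 2) * Re (f x) + cos (pi * \<alpha> / 2) * Im (f x)) > 0"
  shows "\<not> (\<exists>u. global_weak_solution a \<alpha> lam \<gamma> p f u)"
proof
  assume "\<exists>u. global_weak_solution a \<alpha> lam \<gamma> p f u"
  then obtain u where u: "global_weak_solution a \<alpha> lam \<gamma> p f u" ..
  let ?r = "cos (pi * \<alpha> / 2)" and ?s = "sin (pi * \<alpha> / 2)"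
  note u = u[unfolded global_weak_solution_def Let_def]
  from u have L1: "L1_loc ({a..} \<times> UNIV) (\<lambda>(t, x). ln (t / a) powr \<gamma> * norm (u t x) powr p)"
    by blast
  note weak = u[THEN conjunct2, THEN conjunct2, rule_format]
  have Re: "\<bar>Re (u t x)\<bar> \<le> 2 * norm (u t x)" and Im: "\<bar>Im (u t x)\<bar> \<le> 2 * norm (u t x)" for t x
    using abs_Re_le_cmod[of "u t x"] abs_Im_le_cmod[of "u t x"] norm_ge_zero[of "u t x"] by linarith+
  have int: "integrable lebesgue (\<lambda>x. ?r * Re (f x) - ?s * Im (f x))"
      "integrable lebesgue (\<lambda>x. ?s * Re (f x) + ?r * Im (f x))"
    using assms(8) by auto
  \<comment> \<open>The first alternative contradicts the real equation alone, the second the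
    imaginary one.\<close>
  from assms(9) show False
  proof
    assume pos: "Re lam * (LINT x|lebesgue. ?r * Re (f x) - ?s * Im (f x)) > 0"
    show False
      by (rule no_weak_solution_component[OF assms(1-3,5-7) L1 Re abs_component_combination_le(1)
          weak[THEN conjunct1] int(1) pos])
  next
    assume pos: "Im lam * (LINT x|lebesgue. ?s * Re (f x) + ?r * Im (f x)) > 0"
    show False
      by (rule no_weak_solution_component[OF assms(1-3,5-7) L1 Im abs_component_combination_le(2)
          weak[THEN conjunct2] int(2) pos])
  qed
qed

end
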